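(* Let $n\ge1$, $V=\{1,\dots,n\}$, $0<\alpha_1\le\alpha_2\le\cdots\le\alpha_n<1$ and $M,C>0$. Consider the quiz show game with fixed total main prize money $M$ and fixed total consolation prize money $C$ described in the context. If $$\frac MC>\sum_{i=1}^{n-1}\frac{1-\alpha_i}{\alpha_i},$$ then the strategies $\mathbf x^n$ (for the contestant) and $\mathbf y^n$ (for the host) are optimal, where, with $a_i=\frac{M\alpha_i}{1-\alpha_i}$, $b_i=C$, $f(V)=1-\prod_{i=1}^n\alpha_i$ and $\lambda_n=\frac{a_n+b_n}{a_n\sum_{i=1}^n1/a_i}$, $$(\mathbf x^n)^T=\frac{\lambda_nf(V)}{a_n+b_n}\Big(\frac{a_n}{a_1},\dots,\frac{a_n}{a_n}\Big),\qquad \mathbf y^n=\lambda_n(1,\dots,1)^T,$$ and the value of the game is $$v_n=\frac{\big(M\alpha_n/(1-\alpha_n)+C\big)\big(1-\prod_{i=1}^n\alpha_i\big)}{\frac{\alpha_n}{1-\alpha_n}\sum_{i=1}^n(1-\alpha_i)/\alpha_i}.$$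
   Context: Quiz show game with fixed main and consolation prize money. There are $n$ questions. The contestant (maximizer) chooses an order in which to answer the questions; the host (minimizer) chooses main prizes $r_i\ge0$ with $\sum_ir_i=M$ and consolation prizes $r'_i\ge0$ with $\sum_ir'_i=C$. When question $i$ is attempted, with probability $\alpha_i$ it is answered correctly, the contestant receives $r_i$ and proceeds to the next question; with probability $1-\alpha_i$ it is answered incorrectly, she receives $r'_i$ and the game ends. The payoff is the contestant's expected winnings. Let $f(S)=1-\prod_{i\in S}\alpha_i$ for $S\subseteq V$ and $\mathbf x(S)=\sum_{i\in S}x_i$. The contestant's mixed strategy set is identified with $\mathcal B(f)=\{\mathbf x\in\mathbb R^n_+:\ \mathbf x(S)\le f(S)\ \text{for all } S\subseteq V,\ \mathbf x(V)=f(V)\}$, where $x_i$ is the probability that all questions before $i$ are answered correctly and $i$ is answered incorrectly. The host's mixed strategy set is identified with the set of all $\mathbf y\in\mathbb R^n$ with $y_i=\frac{\alpha_i}{1-\alpha_i}r_i+r'_i$ where $r_i,r'_i\ge0$, $\sum_ir_i=M$, $\sum_ir'_i=C$. The expected payoff is $\mathbf x^T\mathbf y$. A contestant strategy is optimal if it attains $\max_{\mathbf x}\min_{\mathbf y}\mathbf x^T\mathbf y$, a host strategy is optimal if it attains $\min_{\mathbf y}\max_{\mathbf x}\mathbf x^T\mathbf y$, and the value is the common value of these. Empty sums are $0$. *)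

theory Defs
  imports Complex_Main "HOL-Library.FuncSet"
begin

definition has_minimum :: "('a \<Rightarrow> real) \<Rightarrow> 'a set \<Rightarrow> real \<Rightarrow> bool" where
  "has_minimum g A m \<longleftrightarrow> (\<exists>a\<in>A. g a = m) \<and> (\<forall>a\<in>A. m \<le> g a)"

definition has_maximum :: "('a \<Rightarrow> real) \<Rightarrow> 'a set \<Rightarrow> real \<Rightarrow> bool" where
  "has_maximum g A m \<longleftrightarrow> (\<exists>a\<in>A. g a = m) \<and> (\<forall>a\<in>A. g a \<le> m)"

text \<open>
  Zero-sum game with strategy set X for the maximizer, Y for the minimizer, and payoff P.
  The inner extremum is required to be attained for every strategy of the outer player
  (the function \<open>\<phi>\<close> collects these extrema), and the outer one is required to be attained as well,
  so these are genuine maxima and minima rather than suprema and infima.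
\<close>

definition is_maximin :: "'x set \<Rightarrow> 'y set \<Rightarrow> ('x \<Rightarrow> 'y \<Rightarrow> real) \<Rightarrow> real \<Rightarrow> bool" where
  "is_maximin X Y P v \<longleftrightarrow>
     (\<exists>\<phi>. (\<forall>x\<in>X. has_minimum (\<lambda>y. P x y) Y (\<phi> x)) \<and> has_maximum \<phi> X v)"

definition is_minimax :: "'x set \<Rightarrow> 'y set \<Rightarrow> ('x \<Rightarrow> 'y \<Rightarrow> real) \<Rightarrow> real \<Rightarrow> bool" where
  "is_minimax X Y P v \<longleftrightarrow>
     (\<exists>\<phi>. (\<forall>y\<in>Y. has_maximum (\<lambda>x. P x y) X (\<phi> y)) \<and> has_minimum \<phi> Y v)"

definition maximizer_optimal :: "'x set \<Rightarrow> 'y set \<Rightarrow> ('x \<Rightarrow> 'y \<Rightarrow> real) \<Rightarrow> 'x \<Rightarrow> bool" where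
  "maximizer_optimal X Y P x \<longleftrightarrow>
     x \<in> X \<and> (\<exists>v. is_maximin X Y P v \<and> has_minimum (\<lambda>y. P x y) Y v)"

definition minimizer_optimal :: "'x set \<Rightarrow> 'y set \<Rightarrow> ('x \<Rightarrow> 'y \<Rightarrow> real) \<Rightarrow> 'y \<Rightarrow> bool" where
  "minimizer_optimal X Y P y \<longleftrightarrow>
     y \<in> Y \<and> (\<exists>v. is_minimax X Y P v \<and> has_maximum (\<lambda>x. P x y) X v)"

definition game_value :: "'x set \<Rightarrow> 'y set \<Rightarrow> ('x \<Rightarrow> 'y \<Rightarrow> real) \<Rightarrow> real \<Rightarrow> bool" where
  "game_value X Y P v \<longleftrightarrow> is_maximin X Y P v \<and> is_minimax X Y P v"

text \<open>
  The quiz show game. A vector of dimension n is an extensional function on \<open>{1..n}\<close>,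
  and \<open>\<alpha> i\<close> is the probability that question i is answered correctly.
\<close>

definition fail_prob :: "(nat \<Rightarrow> real) \<Rightarrow> nat set \<Rightarrow> real" where
  "fail_prob \<alpha> S = 1 - (\<Prod>i\<in>S. \<alpha> i)"

text \<open>
  The base polytope of \<open>fail_prob \<alpha>\<close>. A point x of it represents a mixture of orders of the
  questions: \<open>x i\<close> is the probability that all questions before i are answered correctly
  and i is answered incorrectly.
\<close>

definition contestant_strategies :: "nat \<Rightarrow> (nat \<Rightarrow> real) \<Rightarrow> (nat \<Rightarrow> real) set" where
  "contestant_strategies n \<alpha> =
     {x \<in> {1..n} \<rightarrow>\<^sub>E {0..}.
        (\<forall>S. S \<subseteq> {1..n} \<longrightarrow> (\<Sum>i\<in>S. x i) \<le> fail_prob \<alpha> S) \<and>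
        (\<Sum>i=1..n. x i) = fail_prob \<alpha> {1..n}}"

text \<open>Here r and \<open>r'\<close> are the main and the consolation prizes.\<close>

definition host_strategies ::
  "nat \<Rightarrow> (nat \<Rightarrow> real) \<Rightarrow> real \<Rightarrow> real \<Rightarrow> (nat \<Rightarrow> real) set" where
  "host_strategies n \<alpha> M C =
     {y \<in> {1..n} \<rightarrow>\<^sub>E UNIV.
        \<exists>r r'. (\<forall>i\<in>{1..n}. 0 \<le> r i \<and> 0 \<le> r' i \<and> y i = \<alpha> i / (1 - \<alpha> i) * r i + r' i) \<and>
               (\<Sum>i=1..n. r i) = M \<and> (\<Sum>i=1..n. r' i) = C}"

definition payoff :: "nat \<Rightarrow> (nat \<Rightarrow> real) \<Rightarrow> (nat \<Rightarrow> real) \<Rightarrow> real" where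
  "payoff n x y = (\<Sum>i=1..n. x i * y i)"

end

(*
  Write w i = (1 - \<alpha> i) / \<alpha> i, so that x^n = f(V) w / w(V). The host's strategy y^n is constant, hence
  every contestant strategy earns exactly lam * f(V) against it, and the bound on M / C is what allows
  the host to realise it by placing the whole consolation prize on question n. Conversely x^n earns
  f(V) / w(V) * (M + \<Sum>i. w i * r' i), which is least when the consolation prize is on question n,
  where w is smallest. That x^n lies in the base polytope amounts to f(V) / w(V) \<le> f(S) / w(S).
*)
theory Submission
  imports Defs "HOL-Analysis.Function_Topology"
begin

section \<open>Saddle points of zero-sum games\<close>

text \<open>The two bounds meet at \<open>P x0 y0 = v\<close>. The inner minimum for any
  \<open>x\<close> is at most \<open>P x y0\<close>, hence at most \<open>v\<close>, and dually for
  \<open>y\<close>. The hypotheses \<open>min_ex\<close> and \<open>max_ex\<close> supply the inner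
  extrema for all strategies, which \<open>is_maximin\<close> and \<open>is_minimax\<close> require
  to be attained.\<close>

lemma saddle_point_optimal:
  assumes x: "x0 \<in> X" and y: "y0 \<in> Y"
    and min_ex: "\<And>x. x \<in> X \<Longrightarrow> \<exists>m. has_minimum (\<lambda>y. P x y) Y m"
    and max_ex: "\<And>y. y \<in> Y \<Longrightarrow> \<exists>m. has_maximum (\<lambda>x. P x y) X m"
    and le: "\<And>x. x \<in> X \<Longrightarrow> P x y0 \<le> v"
    and ge: "\<And>y. y \<in> Y \<Longrightarrow> v \<le> P x0 y"
  shows "maximizer_optimal X Y P x0 \<and> minimizer_optimal X Y P y0 \<and> game_value X Y P v"
proof -
  have eq: "P x0 y0 = v"
    using le[OF x] ge[OF y] by simp
  have min0: "has_minimum (\<lambda>y. P x0 y) Y v" and max0: "has_maximum (\<lambda>x. P x y0) X v"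
    unfolding has_minimum_def has_maximum_def using x y eq le ge by auto
  obtain \<phi> where \<phi>: "\<And>x. x \<in> X \<Longrightarrow> has_minimum (\<lambda>y. P x y) Y (\<phi> x)"
    using min_ex by metis
  obtain \<psi> where \<psi>: "\<And>y. y \<in> Y \<Longrightarrow> has_maximum (\<lambda>x. P x y) X (\<psi> y)"
    using max_ex by metis
  have "\<phi> x0 = v"
    using \<phi>[OF x] min0 unfolding has_minimum_def by (metis order_antisym)
  moreover have "\<phi> x \<le> v" if "x \<in> X" for x
    using \<phi>[OF that] le[OF that] y unfolding has_minimum_def by force
  ultimately have maximin: "is_maximin X Y P v"
    unfolding is_maximin_def has_maximum_def using \<phi> x by blast
  have "\<psi> y0 = v"
    using \<psi>[OF y] max0 unfolding has_maximum_def by (metis order_antisym)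
  moreover have "v \<le> \<psi> y" if "y \<in> Y" for y
    using \<psi>[OF that] ge[OF that] x unfolding has_maximum_def by force
  ultimately have minimax: "is_minimax X Y P v"
    unfolding is_minimax_def has_minimum_def using \<psi> y by blast
  show ?thesis
    unfolding maximizer_optimal_def minimizer_optimal_def game_value_def
    using x y min0 max0 maximin minimax by blast
qed

section \<open>Failure probabilities and odds\<close>

text \<open>This is the Weierstrass product inequality: with w = (1 - \<alpha>) / \<alpha> \<ge> 0
  one has 1 + w = 1 / \<alpha>, and the product of the factors 1 + w is at least 1 plus the sum of
  the w.\<close>

lemma prod_times_one_plus_sum_odds_le_1:
  fixes \<alpha> :: "'a \<Rightarrow> real"
  assumes "finite S" "\<And>i. i \<in> S \<Longrightarrow> 0 < \<alpha> i \<and> \<alpha> i \<le> 1"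
  shows "(\<Prod>i\<in>S. \<alpha> i) * (1 + (\<Sum>i\<in>S. (1 - \<alpha> i) / \<alpha> i)) \<le> 1"
  using assms
proof (induction S rule: finite_induct)
  case (insert j S)
  let ?P = "\<Prod>i\<in>S. \<alpha> i" and ?w = "\<Sum>i\<in>S. (1 - \<alpha> i) / \<alpha> i"
  have j: "0 < \<alpha> j" "\<alpha> j \<le> 1"
    using insert.prems by auto
  have "0 \<le> ?P"
    using insert.prems by (intro prod_nonneg) (auto intro: less_imp_le)
  have "0 \<le> ?w"
    using insert.prems by (intro sum_nonneg) (simp add: less_imp_le)
  have "(\<alpha> j * ?P) * (1 + ((1 - \<alpha> j) / \<alpha> j + ?w)) = ?P * (1 + \<alpha> j * ?w)"
    using j by (simp add: field_simps)
  also have "\<dots> \<le> ?P * (1 + ?w)"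
    using \<open>0 \<le> ?P\<close> \<open>0 \<le> ?w\<close> j by (intro mult_left_mono) (auto simp: mult_left_le_one_le)
  also have "\<dots> \<le> 1"
    using insert.IH insert.prems by auto
  finally show ?case
    using insert.hyps by simp
qed simp

text \<open>A new question j raises the failure probability by at most w j times the ratio f(S) /
  w(S), so the ratio cannot grow. The form without division also covers the empty set, where w(S) =
  0.\<close>

lemma fail_prob_per_odds_antimono:
  fixes \<alpha> :: "nat \<Rightarrow> real"
  assumes "finite V" "S \<subseteq> V" "\<And>i. i \<in> V \<Longrightarrow> 0 < \<alpha> i \<and> \<alpha> i \<le> 1"
  shows "fail_prob \<alpha> V * (\<Sum>i\<in>S. (1 - \<alpha> i) / \<alpha> i) \<le> fail_prob \<alpha> S * (\<Sum>i\<in>V. (1 - \<alpha> i) / \<alpha> i)"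
proof -
  define w where "w = (\<lambda>i. (1 - \<alpha> i) / \<alpha> i)"
  have S: "finite S" "\<And>i. i \<in> S \<Longrightarrow> 0 < \<alpha> i \<and> \<alpha> i \<le> 1"
    using assms finite_subset by auto
  have wS: "0 \<le> sum w S"
    unfolding w_def using S by (intro sum_nonneg) (simp add: less_imp_le)
  have PS: "0 \<le> prod \<alpha> S" "prod \<alpha> S * (1 + sum w S) \<le> 1"
    using S prod_times_one_plus_sum_odds_le_1[of S \<alpha>]
    by (auto simp: w_def less_imp_le intro!: prod_nonneg)
  \<comment> \<open>The questions outside \<open>S\<close> are added one by one while
    \<open>S\<close> stays the fixed reference set, so each increment is compared with f(S)
    directly.\<close>
  have union: "fail_prob \<alpha> (S \<union> T) * sum w S \<le> fail_prob \<alpha> S * sum w (S \<union> T)"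
    if "finite T" "T \<inter> S = {}" "\<And>i. i \<in> T \<Longrightarrow> 0 < \<alpha> i \<and> \<alpha> i \<le> 1" for T
    using that
  proof (induction T rule: finite_induct)
    case (insert j T)
    have j: "0 < \<alpha> j" "\<alpha> j \<le> 1" "j \<notin> S \<union> T"
      using insert by auto
    have PT: "0 \<le> prod \<alpha> T" "prod \<alpha> T \<le> 1"
      using insert.prems by (auto simp: less_imp_le intro!: prod_nonneg prod_le_1)
    have PU: "prod \<alpha> (S \<union> T) = prod \<alpha> S * prod \<alpha> T"
      using insert S by (intro prod.union_disjoint) auto
    have "(prod \<alpha> T * \<alpha> j) * (prod \<alpha> S * sum w S) \<le> 1 * (prod \<alpha> S * sum w S)"
      using PT j PS wS by (intro mult_right_mono mult_le_one) auto
    \<comment> \<open>Expanding prod(S) * (1 + w(S)) \<le> 1 gives prod(S) * w(S) \<le> 1 - prod(S),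
      which is f(S).\<close>
    also have "\<dots> \<le> fail_prob \<alpha> S"
      using PS by (simp add: fail_prob_def algebra_simps)
    finally have "((prod \<alpha> T * \<alpha> j) * (prod \<alpha> S * sum w S)) * w j \<le> fail_prob \<alpha> S * w j"
      using j by (intro mult_right_mono) (auto simp: w_def)
    moreover have "1 - \<alpha> j = \<alpha> j * w j"
      using j by (simp add: w_def)
    ultimately have step: "prod \<alpha> (S \<union> T) * (1 - \<alpha> j) * sum w S \<le> fail_prob \<alpha> S * w j"
      by (simp add: PU mult_ac)
    have "fail_prob \<alpha> (S \<union> insert j T) = fail_prob \<alpha> (S \<union> T) + prod \<alpha> (S \<union> T) * (1 - \<alpha> j)"
      using j S insert.hyps by (simp add: fail_prob_def algebra_simps)
    then have "fail_prob \<alpha> (S \<union> insert j T) * sum w S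
        = fail_prob \<alpha> (S \<union> T) * sum w S + prod \<alpha> (S \<union> T) * (1 - \<alpha> j) * sum w S"
      by (simp only: distrib_right)
    also have "\<dots> \<le> fail_prob \<alpha> S * sum w (S \<union> T) + fail_prob \<alpha> S * w j"
      using insert.IH insert.prems step by (intro add_mono) simp_all
    also have "\<dots> = fail_prob \<alpha> S * sum w (S \<union> insert j T)"
      using j S insert.hyps by (simp add: algebra_simps)
    finally show ?case .
  qed simp
  have "S \<union> (V - S) = V"
    using assms(2) by auto
  then show ?thesis
    using union[of "V - S"] assms(1,3) unfolding w_def by auto
qed

section \<open>Attained best responses\<close>

text \<open>By Tychonoff, a box of functions is compact, and the polytope is cut out of it by
  finitely many closed conditions. Compactness yields the attained maxima that
  \<open>is_minimax\<close> demands.\<close>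

lemma compact_contestant_strategies:
  assumes "\<And>i. i \<in> {1..n} \<Longrightarrow> 0 \<le> \<alpha> i"
  shows "compact (contestant_strategies n \<alpha>)"
proof -
  \<comment> \<open>Extensional functions take the value \<open>undefined\<close> off
    \<open>{1..n}\<close>, so those coordinates range over a compact singleton. The bound 1 on the
    others comes from the constraint for one-element sets.\<close>
  define K where "K = (\<Pi>\<^sub>E i\<in>UNIV. if i \<in> {1..n} then {0..1::real} else {undefined})"
  define L where "L = (\<Inter>S\<in>Pow {1..n}. {x::nat \<Rightarrow> real. (\<Sum>i\<in>S. x i) \<le> fail_prob \<alpha> S}) \<inter>
                      {x. (\<Sum>i=1..n. x i) = fail_prob \<alpha> {1..n}}"
  have "compactin (product_topology (\<lambda>i. euclidean) UNIV) K"
    unfolding K_def compactin_PiE by auto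
  then have "compact K"
    by (simp add: euclidean_product_topology)
  moreover have "closed L"
    unfolding L_def by (intro closed_Int closed_INT ballI closed_Collect_le closed_Collect_eq
        continuous_on_sum continuous_on_product_coordinates continuous_on_const)
  ultimately have "compact (K \<inter> L)"
    by (rule compact_Int_closed)
  moreover have "contestant_strategies n \<alpha> = K \<inter> L"
  proof
    show "K \<inter> L \<subseteq> contestant_strategies n \<alpha>"
      by (auto simp: K_def L_def contestant_strategies_def PiE_iff extensional_def split: if_splits)
    show "contestant_strategies n \<alpha> \<subseteq> K \<inter> L"
    proof
      fix x
      assume x: "x \<in> contestant_strategies n \<alpha>"
      have "x i \<le> 1" if "i \<in> {1..n}" for i
      proof -
        have "(\<Sum>i\<in>{i}. x i) \<le> fail_prob \<alpha> {i}"
          using x that unfolding contestant_strategies_def by blast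
        then show ?thesis
          using assms[OF that] by (simp add: fail_prob_def)
      qed
      then show "x \<in> K \<inter> L"
        using x by (auto simp: K_def L_def contestant_strategies_def PiE_iff extensional_def)
    qed
  qed
  ultimately show ?thesis
    by simp
qed

lemma payoff_attains_maximum:
  assumes "\<And>i. i \<in> {1..n} \<Longrightarrow> 0 \<le> \<alpha> i" "contestant_strategies n \<alpha> \<noteq> {}"
  shows "\<exists>m. has_maximum (\<lambda>x. payoff n x y) (contestant_strategies n \<alpha>) m"
proof -
  have "continuous_on (contestant_strategies n \<alpha>) (\<lambda>x. payoff n x y)"
    unfolding payoff_def
    by (intro continuous_on_sum continuous_on_mult continuous_on_const
        continuous_on_subset[OF continuous_on_product_coordinates]) auto
  from continuous_attains_sup[OF compact_contestant_strategies[OF assms(1)] assms(2) this]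
  show ?thesis
    unfolding has_maximum_def by auto
qed

lemma host_strategiesI:
  assumes "\<And>i. i \<in> {1..n} \<Longrightarrow> 0 \<le> r i \<and> 0 \<le> r' i \<and> y i = \<alpha> i / (1 - \<alpha> i) * r i + r' i"
    and "(\<Sum>i=1..n. r i) = M" "(\<Sum>i=1..n. r' i) = C" "y \<in> extensional {1..n}"
  shows "y \<in> host_strategies n \<alpha> M C"
  unfolding host_strategies_def PiE_iff using assms by blast

lemma payoff_host:
  assumes "\<And>i. i \<in> {1..n} \<Longrightarrow> y i = \<alpha> i / (1 - \<alpha> i) * r i + r' i"
  shows "payoff n x y = (\<Sum>i=1..n. x i * (\<alpha> i / (1 - \<alpha> i)) * r i) + (\<Sum>i=1..n. x i * r' i)"
  unfolding payoff_def sum.distrib[symmetric]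
  by (intro sum.cong) (simp_all add: assms algebra_simps)

lemma scaled_min_le_weighted_sum:
  fixes c r :: "'a \<Rightarrow> real"
  assumes "\<And>i. i \<in> I \<Longrightarrow> m \<le> c i" "\<And>i. i \<in> I \<Longrightarrow> 0 \<le> r i"
  shows "m * (\<Sum>i\<in>I. r i) \<le> (\<Sum>i\<in>I. c i * r i)"
  unfolding sum_distrib_left by (intro sum_mono mult_right_mono assms)

text \<open>The payoff is linear in the prizes, so the host does best by concentrating each kind of prize
  on a single question.\<close>

lemma payoff_attains_minimum:
  assumes "n \<ge> 1" "0 \<le> M" "0 \<le> C"
  shows "\<exists>m. has_minimum (\<lambda>y. payoff n x y) (host_strategies n \<alpha> M C) m"
proof -
  have minimizer: "\<exists>k\<in>{1..n}. \<forall>i\<in>{1..n}. c k \<le> c i" for c :: "nat \<Rightarrow> real"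
    using ex_is_arg_min_if_finite[of "{1..n}" c] assms(1) by (force simp: is_arg_min_linorder)
  \<comment> \<open>A unit of main prize on question i costs the host \<open>c i\<close>, a unit of
    consolation prize costs \<open>x i\<close>. The two budgets are minimised independently, so
    \<open>k\<close> and \<open>l\<close> may differ.\<close>
  define c where "c = (\<lambda>i. x i * (\<alpha> i / (1 - \<alpha> i)))"
  obtain k where k: "k \<in> {1..n}" "\<And>i. i \<in> {1..n} \<Longrightarrow> c k \<le> c i"
    using minimizer by metis
  obtain l where l: "l \<in> {1..n}" "\<And>i. i \<in> {1..n} \<Longrightarrow> x l \<le> x i"
    using minimizer by metis
  define r where "r = (\<lambda>i. if i = k then M else 0)"
  define r' where "r' = (\<lambda>i. if i = l then C else 0)"
  define y where "y = (\<lambda>i\<in>{1..n}. \<alpha> i / (1 - \<alpha> i) * r i + r' i)"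
  have y: "y \<in> host_strategies n \<alpha> M C"
  proof (rule host_strategiesI)
    show "0 \<le> r i \<and> 0 \<le> r' i \<and> y i = \<alpha> i / (1 - \<alpha> i) * r i + r' i" if "i \<in> {1..n}" for i
      using that assms by (simp add: y_def r_def r'_def)
  qed (use k l in \<open>simp_all add: y_def r_def r'_def\<close>)
  have "payoff n x y = (\<Sum>i=1..n. c i * r i) + (\<Sum>i=1..n. x i * r' i)"
    unfolding c_def by (rule payoff_host) (simp add: y_def)
  also have "\<dots> = c k * M + x l * C"
    using k l by (simp add: r_def r'_def if_distrib cong: if_cong)
  finally have val: "payoff n x y = c k * M + x l * C" .
  have "c k * M + x l * C \<le> payoff n x z" if z: "z \<in> host_strategies n \<alpha> M C" for z
  proof -
    obtain s s' where s: "\<And>i. i \<in> {1..n} \<Longrightarrow> 0 \<le> s i \<and> 0 \<le> s' i \<and> z i = \<alpha> i / (1 - \<alpha> i) * s i + s' i"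
      "(\<Sum>i=1..n. s i) = M" "(\<Sum>i=1..n. s' i) = C"
      using z unfolding host_strategies_def by blast
    have "payoff n x z = (\<Sum>i=1..n. c i * s i) + (\<Sum>i=1..n. x i * s' i)"
      unfolding c_def by (rule payoff_host) (use s in simp)
    then show ?thesis
      using scaled_min_le_weighted_sum[of "{1..n}" "c k" c s]
        scaled_min_le_weighted_sum[of "{1..n}" "x l" x s'] s k l by simp
  qed
  then show ?thesis
    unfolding has_minimum_def using y val by metis
qed

section \<open>The saddle point of the quiz game\<close>

theorem corollary5:
  fixes n :: nat and \<alpha> a b :: "nat \<Rightarrow> real" and M C lam :: real
  assumes "n \<ge> 1"
    and "0 < \<alpha> 1" and "mono_on {1..n} \<alpha>" and "\<alpha> n < 1"
    and "M > 0" and "C > 0"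
    and "M / C > (\<Sum>i=1..n-1. (1 - \<alpha> i) / \<alpha> i)"
    and "a = (\<lambda>i. M * \<alpha> i / (1 - \<alpha> i))"
    and "b = (\<lambda>i. C)"
    and "lam = (a n + b n) / (a n * (\<Sum>i=1..n. 1 / a i))"
  shows "maximizer_optimal (contestant_strategies n \<alpha>) (host_strategies n \<alpha> M C) (payoff n)
           (\<lambda>i\<in>{1..n}. lam * fail_prob \<alpha> {1..n} / (a n + b n) * (a n / a i)) \<and>
         minimizer_optimal (contestant_strategies n \<alpha>) (host_strategies n \<alpha> M C) (payoff n)
           (\<lambda>i\<in>{1..n}. lam) \<and>
         game_value (contestant_strategies n \<alpha>) (host_strategies n \<alpha> M C) (payoff n)
           ((M * \<alpha> n / (1 - \<alpha> n) + C) * (1 - (\<Prod>i=1..n. \<alpha> i)) /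
            (\<alpha> n / (1 - \<alpha> n) * (\<Sum>i=1..n. (1 - \<alpha> i) / \<alpha> i)))"
proof -
  define w where "w = (\<lambda>i. (1 - \<alpha> i) / \<alpha> i)"
  define W where "W = (\<Sum>i=1..n. w i)"
  define F where "F = fail_prob \<alpha> {1..n}"
  have \<alpha>: "0 < \<alpha> i" "\<alpha> i < 1" "\<alpha> i \<le> \<alpha> n" if "i \<in> {1..n}" for i
    using that assms(1-4) mono_onD[OF assms(3), of 1 i] mono_onD[OF assms(3), of i n] by auto
  have n: "n \<in> {1..n}"
    using assms(1) by simp
  have w: "0 < w i" if "i \<in> {1..n}" for i
    using \<alpha>[OF that] by (simp add: w_def)
  have w_min: "w n \<le> w i" if "i \<in> {1..n}" for i
    unfolding w_def using \<alpha>[OF that] \<alpha>[OF n] by (intro frac_le) auto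
  have odds: "\<alpha> i / (1 - \<alpha> i) = 1 / w i" for i
    by (simp add: w_def)
  have W: "0 < W"
    unfolding W_def using w n by (intro sum_pos) auto
  \<comment> \<open>The bound on M / C sums only up to n - 1; this split relates it to the full sum
    \<open>W\<close>.\<close>
  have W_split: "W = (\<Sum>i=1..n-1. w i) + w n"
    unfolding W_def using assms(1) by (cases n) auto
  have a: "a i = M / w i" for i
    by (simp add: assms(8) w_def)
  have ab: "0 < a n + b n"
    using assms(5,6,9) w[OF n] by (simp add: a add_pos_pos)
  have sum_a: "(\<Sum>i=1..n. 1 / a i) = W / M"
    by (simp add: a W_def sum_divide_distrib)
  have lam: "lam = (M + C * w n) / W"
    unfolding assms(10) sum_a using assms(5) W w[OF n]
    by (simp add: a assms(9) field_simps)
  have "(\<Prod>i=1..n. \<alpha> i) \<le> 1"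
    using \<alpha> by (intro prod_le_1) (auto intro: less_imp_le)
  then have F: "0 \<le> F"
    by (simp add: F_def fail_prob_def)
  let ?x = "\<lambda>i\<in>{1..n}. lam * fail_prob \<alpha> {1..n} / (a n + b n) * (a n / a i)"
  let ?y = "\<lambda>i\<in>{1..n}. lam"
  let ?X = "contestant_strategies n \<alpha>" and ?Y = "host_strategies n \<alpha> M C"
  let ?v = "(M * \<alpha> n / (1 - \<alpha> n) + C) * (1 - (\<Prod>i=1..n. \<alpha> i)) /
            (\<alpha> n / (1 - \<alpha> n) * (\<Sum>i=1..n. (1 - \<alpha> i) / \<alpha> i))"
  have v: "?v = lam * F"
  proof -
    have "?v = (M * (\<alpha> n / (1 - \<alpha> n)) + C) * F / (\<alpha> n / (1 - \<alpha> n) * W)"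
      by (simp add: F_def fail_prob_def W_def w_def)
    also have "\<dots> = lam * F"
      unfolding odds lam using W w[OF n] by (simp add: field_simps)
    finally show ?thesis .
  qed
  have x: "?x i = F / W * w i" if "i \<in> {1..n}" for i
  proof -
    \<comment> \<open>The factor \<open>a n + b n\<close> cancels against the numerator of
      \<open>lam\<close>, and then M cancels too, so the contestant's strategy depends on \<alpha>
      alone.\<close>
    have lam_ab: "lam / (a n + b n) = 1 / (a n * (W / M))"
      unfolding assms(10) sum_a using ab by simp
    have "?x i = lam / (a n + b n) * F * (a n / a i)"
      using that by (simp add: F_def)
    also have "\<dots> = F / W * w i"
      unfolding lam_ab unfolding a using assms(5) W w[OF n] w[OF that] by (simp add: field_simps)
    finally show ?thesis .
  qed
  have sum_x: "(\<Sum>i\<in>S. ?x i) = F / W * (\<Sum>i\<in>S. w i)" if "S \<subseteq> {1..n}" for S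
    unfolding sum_distrib_left using that x by (intro sum.cong) auto
  have x_mem: "?x \<in> ?X"
    unfolding contestant_strategies_def
  proof (intro CollectI conjI allI impI)
    have "0 \<le> ?x i" if "i \<in> {1..n}" for i
      unfolding x[OF that] using F W w[OF that] by simp
    then show "?x \<in> {1..n} \<rightarrow>\<^sub>E {0..}"
      by (intro PiE_I) auto
    show "(\<Sum>i=1..n. ?x i) = fail_prob \<alpha> {1..n}"
      using sum_x[of "{1..n}"] W by (simp add: W_def F_def)
    \<comment> \<open>After multiplication by \<open>W\<close> > 0 this is the comparison of f(V) /
      w(V) with f(S) / w(S).\<close>
    show "(\<Sum>i\<in>S. ?x i) \<le> fail_prob \<alpha> S" if S: "S \<subseteq> {1..n}" for S
      unfolding sum_x[OF S]
      using fail_prob_per_odds_antimono[of "{1..n}" S \<alpha>] S \<alpha> W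
      by (simp add: F_def W_def w_def field_simps less_imp_le)
  qed
  have y_mem: "?y \<in> ?Y"
  proof -
    \<comment> \<open>Without a consolation prize, y i = r i / w i equals \<open>lam\<close> exactly
      when r i = lam * w i. Question n receives the rest of M.\<close>
    define r where "r = (\<lambda>i. if i = n then M - lam * (W - w n) else lam * w i)"
    define r' where "r' = (\<lambda>i. if i = n then C else 0)"
    have "C * (\<Sum>i=1..n-1. w i) < M"
      using assms(6,7) by (simp add: w_def field_simps)
    then have "C * W \<le> M + C * w n"
      by (simp add: W_split algebra_simps)
    \<comment> \<open>This makes the main prize left for question n nonnegative, since it equals
      (lam - C) * w n; together with C it gives y n = lam.\<close>
    then have "C \<le> lam"
      using W by (simp add: lam field_simps)
    have lamW: "lam * W = M + C * w n"
      using W by (simp add: lam)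
    have r_n: "r n = (lam - C) * w n"
      using lamW by (simp add: r_def algebra_simps)
    have prizes: "0 \<le> r i \<and> 0 \<le> r' i \<and> ?y i = \<alpha> i / (1 - \<alpha> i) * r i + r' i" if "i \<in> {1..n}" for i
      using that w[OF that] r_n \<open>C \<le> lam\<close> assms(6) unfolding odds
      by (cases "i = n") (auto simp: r_def r'_def)
    have sum_r: "(\<Sum>i=1..n. r i) = M"
    proof -
      have "(\<Sum>i=1..n. r i) = (\<Sum>i=1..n-1. r i) + r n"
        using assms(1) by (cases n) auto
      also have "(\<Sum>i=1..n-1. r i) = lam * (\<Sum>i=1..n-1. w i)"
        unfolding sum_distrib_left using assms(1) by (intro sum.cong) (auto simp: r_def)
      finally show ?thesis
        by (simp add: r_def W_split)
    qed
    have sum_r': "(\<Sum>i=1..n. r' i) = C"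
      using n by (simp add: r'_def)
    show ?thesis
      using prizes sum_r sum_r' by (rule host_strategiesI) (assumption | rule restrict_extensional)+
  qed
  show ?thesis
  proof (rule saddle_point_optimal[OF x_mem y_mem])
    show "\<exists>m. has_minimum (\<lambda>y. payoff n x y) ?Y m" for x
      using assms(1,5,6) by (intro payoff_attains_minimum) auto
    show "\<exists>m. has_maximum (\<lambda>x. payoff n x y) ?X m" for y
      using \<alpha> x_mem by (intro payoff_attains_maximum) (auto intro: less_imp_le)
    show "payoff n x ?y \<le> ?v" if "x \<in> ?X" for x
    proof -
      have "payoff n x ?y = (\<Sum>i=1..n. x i) * lam"
        by (simp add: payoff_def sum_distrib_right)
      then show ?thesis
        using that unfolding v by (simp add: contestant_strategies_def F_def)
    qed
    show "?v \<le> payoff n ?x y" if y: "y \<in> ?Y" for y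
    proof -
      obtain r r' where r: "\<And>i. i \<in> {1..n} \<Longrightarrow> 0 \<le> r i \<and> 0 \<le> r' i \<and> y i = \<alpha> i / (1 - \<alpha> i) * r i + r' i"
        "(\<Sum>i=1..n. r i) = M" "(\<Sum>i=1..n. r' i) = C"
        using y unfolding host_strategies_def by blast
      have "payoff n ?x y = (\<Sum>i=1..n. ?x i * (\<alpha> i / (1 - \<alpha> i)) * r i) + (\<Sum>i=1..n. ?x i * r' i)"
        by (rule payoff_host) (use r in blast)
      \<comment> \<open>The weight w i in the contestant's strategy cancels the odds 1 / w i, so she
        is indifferent to how the main prize money is distributed.\<close>
      also have "(\<Sum>i=1..n. ?x i * (\<alpha> i / (1 - \<alpha> i)) * r i) = (\<Sum>i=1..n. F / W * r i)"
      proof (rule sum.cong[OF refl])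
        fix i
        assume i: "i \<in> {1..n}"
        show "?x i * (\<alpha> i / (1 - \<alpha> i)) * r i = F / W * r i"
          unfolding x[OF i] odds using w[OF i] by simp
      qed
      also have "\<dots> = F / W * M"
        by (simp only: sum_distrib_left[symmetric] r(2))
      also have "(\<Sum>i=1..n. ?x i * r' i) = (\<Sum>i=1..n. F / W * w i * r' i)"
        using x by (intro sum.cong) auto
      finally have "payoff n ?x y = F / W * M + (\<Sum>i=1..n. F / W * w i * r' i)" .
      \<comment> \<open>Since \<alpha> is largest at n, \<open>w n\<close> is the least weight, and
        the whole consolation budget counts for at least that much.\<close>
      moreover have "F / W * w n * C \<le> (\<Sum>i=1..n. F / W * w i * r' i)"
        using scaled_min_le_weighted_sum[of "{1..n}" "F / W * w n" "\<lambda>i. F / W * w i" r']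
          r(1,3) w_min F W by (simp add: mult_left_mono divide_right_mono)
      moreover have "?v = F / W * M + F / W * w n * C"
        unfolding v lam by (simp add: add_divide_distrib algebra_simps)
      ultimately show ?thesis
        by simp
    qed
  qed
qed

end
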